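(* Let $k$ be a field and let $R=k[t^a,t^b]\subseteq k[t]$, where $1<a<b$ are coprime integers. Then $$\mathbf{ggl}(R)=ba-b+1.$$
   Context: The ring $R$ is positively graded by giving $t^c$ degree $c$. For a positively graded Noetherian $k$-algebra $R=\bigoplus_{i\ge 0}R_i$ with $R_0=k$, put $\mathfrak{m}_n=\bigoplus_{i\ge n}R_i$; the generalized graded length $\mathbf{ggl}(R)$ is the smallest positive integer $n$ for which $\mathfrak{m}_n$ is contained in the ideal generated by some homogeneous system of parameters of $R$. *)

theory Defs
  imports
    "HOL-Algebra.Algebra"
    "HOL-Decision_Procs.Algebra_Aux"
    "HOL-Computational_Algebra.Polynomial"
    "HOL-Library.Extended_Nat"
begin

text \<open>
  Length n of a chain P 0 < ... < P n of prime ideals is the number of strict inclusions. The zero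
  ring has no prime ideals and gets the value 0 here.
\<close>

definition krull_dim :: "('a, 'm) ring_scheme \<Rightarrow> enat" where
  "krull_dim R = Sup {enat n | n.
     \<exists>P :: nat \<Rightarrow> 'a set. (\<forall>i\<le>n. primeideal (P i) R) \<and> (\<forall>i<n. P i \<subset> P (Suc i))}"

text \<open>
  A grading of a ring R is given by its family of homogeneous components G 0, G 1, .... The
  definitions below are meant for positively graded Noetherian k-algebras with G 0 = k.
\<close>

definition tail_ideal :: "('a, 'm) ring_scheme \<Rightarrow> (nat \<Rightarrow> 'a set) \<Rightarrow> nat \<Rightarrow> 'a set" where
  "tail_ideal R G n =
     {finsum R f I | f I. finite I \<and> I \<subseteq> {n..} \<and> (\<forall>i\<in>I. f i \<in> G i)}"

text \<open>
  As the members of the system have positive degree, the ideal they generate is proper, so the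
  quotient is never the zero ring.
\<close>

definition homogeneous_sop ::
  "('a, 'm) ring_scheme \<Rightarrow> (nat \<Rightarrow> 'a set) \<Rightarrow> 'a list \<Rightarrow> bool" where
  "homogeneous_sop R G xs \<longleftrightarrow>
     enat (length xs) = krull_dim R \<and>
     (\<forall>x\<in>set xs. \<exists>d>0. x \<in> G d) \<and>
     krull_dim (R Quot (genideal R (set xs))) = 0"

definition ggl :: "('a, 'm) ring_scheme \<Rightarrow> (nat \<Rightarrow> 'a set) \<Rightarrow> nat" where
  "ggl R G =
     (LEAST n. 0 < n \<and>
        (\<exists>xs. homogeneous_sop R G xs \<and> tail_ideal R G n \<subseteq> genideal R (set xs)))"

text \<open>The k-algebra k[t^a, t^b]: the subring of k[t] generated by the constants, t^a and t^b.\<close>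

definition monomial_curve_ring :: "nat \<Rightarrow> nat \<Rightarrow> 'k::field poly ring" where
  "monomial_curve_ring a b =
     cring_class_ops\<lparr>carrier :=
       generate_ring cring_class_ops (range (\<lambda>c. [:c:]) \<union> {monom 1 a, monom 1 b})\<rparr>"

definition monomial_curve_grading :: "nat \<Rightarrow> nat \<Rightarrow> nat \<Rightarrow> 'k::field poly set" where
  "monomial_curve_grading a b d =
     {p \<in> carrier (monomial_curve_ring a b). \<exists>c. p = monom c d}"

end

theory Submission
  imports Defs "HOL-Number_Theory.Cong"
begin

text \<open>
  Let \<open>S\<close> be the numerical semigroup generated by \<open>a\<close> and \<open>b\<close>. A polynomial lies in the ring
  \<open>R = k[t^a, t^b]\<close> iff all exponents occurring in it lie in \<open>S\<close> (\<open>carrier_monomial_curve_ring\<close>),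
  so questions about monomials of \<open>R\<close> are questions about \<open>S\<close>. Sylvester's theorem supplies what
  is needed: the Frobenius number \<open>F = a b - a - b\<close> is not in \<open>S\<close>, and everything above it is.

  The ring has Krull dimension one, hence a homogeneous system of parameters is a single
  homogeneous element of positive degree. It is nonzero, because the ideal it generates contains
  all elements of large degree; so it is a scalar multiple of \<open>t^d\<close> with \<open>0 < d \<in> S\<close>. Conversely
  every such \<open>t^d\<close> is a system of parameters. Now \<open>t^i\<close> lies in the ideal \<open>(t^d)\<close> iff \<open>i - d \<in> S\<close>.
  This holds for all \<open>i > F + d\<close> and fails for \<open>i = F + d\<close>, although \<open>F + d > F\<close> is in \<open>S\<close>. Hence
  \<open>n = F + d + 1\<close> is the least bound with the tail ideal of degree \<open>n\<close> inside \<open>(t^d)\<close>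
  (\<open>tail_ideal_subset_monom_iff\<close>). It is smallest for the smallest positive element \<open>d = a\<close> of \<open>S\<close>,
  where it equals \<open>a b - b + 1\<close>.

  The dimension statements, for \<open>R\<close> and for \<open>R/(t^d)\<close>, both follow from \<open>nonzero_prime_maximal\<close>.
  If \<open>f \<noteq> 0\<close> lies in a prime \<open>P\<close>, then \<open>R/(f)\<close> is finite-dimensional over \<open>k\<close>, because a
  leading term of large degree can be cancelled by a multiple of \<open>f\<close>. So each element of \<open>R/P\<close> is
  algebraic over \<open>k\<close>, and a domain algebraic over a field is a field.
\<close>

section \<open>The numerical semigroup generated by two coprime numbers\<close>

definition semigroup2 :: "nat \<Rightarrow> nat \<Rightarrow> nat set" where
  "semigroup2 a b = {a * x + b * y | x y. True}"

lemma semigroup2I: "a * x + b * y \<in> semigroup2 a b"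
  by (auto simp: semigroup2_def)

lemma zero_in_semigroup2: "0 \<in> semigroup2 a b"
  using semigroup2I[of a 0 b 0] by simp

lemma left_in_semigroup2: "a \<in> semigroup2 a b"
  using semigroup2I[of a 1 b 0] by simp

lemma right_in_semigroup2: "b \<in> semigroup2 a b"
  using semigroup2I[of a 0 b 1] by simp

lemma semigroup2_add:
  assumes "m \<in> semigroup2 a b" "n \<in> semigroup2 a b"
  shows "m + n \<in> semigroup2 a b"
proof -
  obtain x y x' y' where "m = a * x + b * y" "n = a * x' + b * y'"
    using assms by (auto simp: semigroup2_def)
  then have "m + n = a * (x + x') + b * (y + y')"
    by (simp add: algebra_simps)
  then show ?thesis
    by (metis semigroup2I)
qed

lemma le_if_pos_in_semigroup2:
  assumes "a \<le> b" "d \<in> semigroup2 a b" "0 < d"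
  shows "a \<le> d"
proof -
  obtain x y where d: "d = a * x + b * y"
    using assms(2) by (auto simp: semigroup2_def)
  with assms(3) have "0 < x \<or> 0 < y"
    by (cases x; cases y) auto
  then show ?thesis
    using assms(1) d by (cases x; cases y) auto
qed

text \<open>
  As \<open>b\<close> is invertible modulo \<open>a\<close>, some \<open>b y\<close> with \<open>y < a\<close> is congruent to \<open>n\<close>, and only
  \<open>b y \<le> n\<close> is needed to write \<open>n = a k + b y\<close>. Otherwise \<open>n\<close> is at least \<open>a\<close> below \<open>b y\<close>, which is at
  most \<open>b (a - 1)\<close>, so \<open>n \<le> a b - a - b\<close>. The bound on \<open>n\<close> is phrased without subtraction.
\<close>

lemma in_semigroup2_if_above_frobenius:
  assumes "coprime a b" "0 < a" "a * b < n + a + b"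
  shows "n \<in> semigroup2 a b"
proof -
  obtain x where x: "[b * x = 1] (mod a)"
    using cong_solve_coprime_nat[of b a] assms(1) by (auto simp: coprime_commute)
  define y where "y = (x * n) mod a"
  have "[b * (x * n) = n] (mod a)"
    using cong_scalar_right[OF x, of n] by (simp add: mult.assoc)
  then have y: "[b * y = n] (mod a)"
    unfolding y_def by (simp add: cong_def mod_mult_right_eq)
  show ?thesis
  proof (cases "b * y \<le> n")
    case True
    then have "a dvd n - b * y"
      using y by (metis cong_sym cong_altdef_nat)
    then obtain k where "n - b * y = a * k" ..
    then have "n = a * k + b * y"
      using True by simp
    then show ?thesis
      by (metis semigroup2I)
  next
    case False
    then have "a dvd b * y - n"
      using y by (metis cong_altdef_nat nat_le_linear)
    then have "a \<le> b * y - n"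
      using False by (simp add: dvd_imp_le)
    moreover have "b * (y + 1) \<le> b * a"
      using assms(2) by (intro mult_le_mono2) (simp add: y_def Suc_leI)
    ultimately have "n + a + b \<le> a * b"
      using False by (simp add: algebra_simps)
    then show ?thesis
      using assms(3) by simp
  qed
qed

text \<open>
  A representation of \<open>a b - a - b\<close> would yield \<open>a b = a (x + 1) + b (y + 1)\<close> with positive summands;
  coprimality makes \<open>y + 1\<close> a multiple of \<open>a\<close>, so the second summand alone is at least \<open>a b\<close>.
\<close>

lemma frobenius_notin_semigroup2:
  assumes "coprime a b" "0 < a" "0 < b" "n + a + b = a * b"
  shows "n \<notin> semigroup2 a b"
proof
  assume "n \<in> semigroup2 a b"
  then obtain x y where "n = a * x + b * y"
    by (auto simp: semigroup2_def)
  then have eq: "a * (x + 1) + b * (y + 1) = a * b"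
    using assms(4) by (simp add: algebra_simps)
  have "a dvd b * (y + 1)"
    by (metis eq dvd_add_right_iff dvd_triv_left)
  then have "a dvd y + 1"
    using assms(1) coprime_dvd_mult_right_iff by blast
  then have "a \<le> y + 1"
    by (intro dvd_imp_le) auto
  then have "a * b \<le> b * (y + 1)"
    by (metis mult.commute mult_le_mono2)
  moreover have "0 < a * (x + 1)"
    using assms(2) by simp
  ultimately show False
    using eq by linarith
qed

section \<open>The ring as the polynomials supported on the semigroup\<close>

lemma monomial_curve_ring_simps:
  "monoid.mult (monomial_curve_ring a b) = (*)"
  "monoid.one (monomial_curve_ring a b) = 1"
  "ring.zero (monomial_curve_ring a b) = 0"
  "ring.add (monomial_curve_ring a b) = (+)"
  by (simp_all add: monomial_curve_ring_def cring_class_ops_def)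

text \<open>
  Having its support in a semigroup is a property of the constants and of the two generators that is
  inherited by sums and products. Conversely, each monomial with exponent \<open>a x + b y\<close> is a scalar
  multiple of a product of powers of the generators.
\<close>

lemma carrier_monomial_curve_ring:
  "carrier (monomial_curve_ring a b :: 'k::field poly ring) =
     {p. \<forall>i. coeff p i \<noteq> 0 \<longrightarrow> i \<in> semigroup2 a b}" (is "?C = ?P")
proof -
  let ?G = "range (\<lambda>c. [:c:]) \<union> {monom 1 a, monom 1 b :: 'k poly}"
  have C: "?C = generate_ring cring_class_ops ?G"
    by (simp add: monomial_curve_ring_def)
  have one: "1 \<in> ?C"
    unfolding C using generate_ring.one[of "cring_class_ops :: 'k poly ring" ?G]
    by (simp add: class_simps)
  have gen: "p \<in> ?C" if "p \<in> ?G" for p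
    unfolding C using that by (rule generate_ring.incl)
  have add: "p + q \<in> ?C" if "p \<in> ?C" "q \<in> ?C" for p q
    using generate_ring.eng_add[OF that[unfolded C]] unfolding C by (simp add: class_simps)
  have mult: "p * q \<in> ?C" if "p \<in> ?C" "q \<in> ?C" for p q
    using generate_ring.eng_mult[OF that[unfolded C]] unfolding C by (simp add: class_simps)
  have pow: "p ^ n \<in> ?C" if "p \<in> ?C" for p n
    by (induction n) (simp_all add: one mult that)
  show ?thesis
  proof
    show "?C \<subseteq> ?P"
    proof
      fix p :: "'k poly" assume "p \<in> ?C"
      then show "p \<in> ?P"
        unfolding C
      proof induction
        case one
        then show ?case
          by (auto simp: class_simps zero_in_semigroup2)
      next
        case (incl p)
        then show ?case
          by (auto simp: coeff_pCons zero_in_semigroup2 left_in_semigroup2 right_in_semigroup2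
              split: nat.splits if_splits)
      next
        case (eng_add p q)
        have "i \<in> semigroup2 a b" if "coeff (p + q) i \<noteq> 0" for i
        proof -
          have "coeff p i \<noteq> 0 \<or> coeff q i \<noteq> 0"
            using that by auto
          then show ?thesis
            using eng_add by auto
        qed
        then show ?case
          by (simp add: class_simps)
      next
        case (eng_mult p q)
        have "i \<in> semigroup2 a b" if nz: "coeff (p * q) i \<noteq> 0" for i
        proof -
          obtain j where "j \<le> i" "coeff p j * coeff q (i - j) \<noteq> 0"
            by (rule sum.not_neutral_contains_not_neutral[OF nz[unfolded coeff_mult]]) auto
          then have "j \<in> semigroup2 a b" "i - j \<in> semigroup2 a b"
            using eng_mult by auto
          then have "j + (i - j) \<in> semigroup2 a b"
            by (rule semigroup2_add)
          then show ?thesis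
            using \<open>j \<le> i\<close> by simp
        qed
        then show ?case
          by (simp add: class_simps)
      qed (simp add: class_simps)
    qed
  next
    have monom: "monom c i \<in> ?C" if i: "i \<in> semigroup2 a b" for c i
    proof -
      obtain x y where "i = a * x + b * y"
        using i by (auto simp: semigroup2_def)
      then have "monom c i = [:c:] * (monom 1 a ^ x * monom 1 b ^ y)"
        by (simp add: monom_power mult_monom smult_monom)
      also have "\<dots> \<in> ?C"
        by (intro mult pow gen) auto
      finally show ?thesis .
    qed
    show "?P \<subseteq> ?C"
    proof
      fix p :: "'k poly" assume p: "p \<in> ?P"
      have "(\<Sum>i\<le>n. monom (coeff p i) i) \<in> ?C" for n
      proof (induction n)
        case 0
        then show ?case
          using gen[of "[:coeff p 0:]"] by (simp add: monom_0)
      next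
        case (Suc n)
        have "monom (coeff p (Suc n)) (Suc n) \<in> ?C"
        proof (cases "coeff p (Suc n) = 0")
          case True
          then show ?thesis
            using monom[OF zero_in_semigroup2, of 0] by simp
        next
          case False
          then show ?thesis
            using p monom by blast
        qed
        with Suc show ?case
          by (simp add: add)
      qed
      then show "p \<in> ?C"
        by (metis poly_as_sum_of_monoms)
    qed
  qed
qed

lemma monom_in_monomial_curve_ring:
  "monom c i \<in> carrier (monomial_curve_ring a b) \<longleftrightarrow> c = 0 \<or> i \<in> semigroup2 a b"
  by (auto simp: carrier_monomial_curve_ring)

lemma const_in_monomial_curve_ring: "[:c:] \<in> carrier (monomial_curve_ring a b)"
  using monom_in_monomial_curve_ring[of c 0] by (simp add: monom_0 zero_in_semigroup2)

lemma domain_monomial_curve_ring: "domain (monomial_curve_ring a b :: 'k::field poly ring)"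
proof -
  let ?S = "cring_class_ops :: 'k poly ring"
  let ?H = "generate_ring ?S (range (\<lambda>c. [:c:]) \<union> {monom 1 a, monom 1 b})"
  have S: "cring ?S" "ring ?S"
    using cring_class cring.axioms(1) by blast+
  have H: "subring ?H ?S"
    by (rule ring.generate_ring_is_subring[OF S(2)]) (simp add: cring_class_ops_def)
  then have "cring (?S\<lparr>carrier := ?H\<rparr>)"
    using ring.subcring_iff[OF S(2) subringE(1)[OF H]] cring.subcringI'[OF S(1) H] by blast
  then have "cring (monomial_curve_ring a b :: 'k poly ring)"
    by (simp add: monomial_curve_ring_def)
  then show ?thesis
    by (intro domain.intro domain_axioms.intro) (simp_all add: monomial_curve_ring_simps)
qed

lemma cring_monomial_curve_ring: "cring (monomial_curve_ring a b :: 'k::field poly ring)"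
  using domain_monomial_curve_ring by (rule domain.axioms)

lemma monomial_curve_ring_closed:
  fixes p q :: "'k::field poly"
  assumes p: "p \<in> carrier (monomial_curve_ring a b)"
  shows "q \<in> carrier (monomial_curve_ring a b) \<Longrightarrow> p + q \<in> carrier (monomial_curve_ring a b)"
    and "q \<in> carrier (monomial_curve_ring a b) \<Longrightarrow> p * q \<in> carrier (monomial_curve_ring a b)"
    and "- p \<in> carrier (monomial_curve_ring a b)"
    and "smult c p \<in> carrier (monomial_curve_ring a b)"
    and "p ^ n \<in> carrier (monomial_curve_ring a b)"
proof -
  interpret cring "monomial_curve_ring a b :: 'k poly ring"
    by (rule cring_monomial_curve_ring)
  show add: "p + q \<in> carrier (monomial_curve_ring a b)"
    if "q \<in> carrier (monomial_curve_ring a b)"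
    using a_closed[OF p that] by (simp add: monomial_curve_ring_simps)
  show mult: "p * q \<in> carrier (monomial_curve_ring a b)"
    if "q \<in> carrier (monomial_curve_ring a b)" for q
    using m_closed[OF p that] by (simp add: monomial_curve_ring_simps)
  show "- p \<in> carrier (monomial_curve_ring a b)" "smult c p \<in> carrier (monomial_curve_ring a b)"
    using p by (auto simp: carrier_monomial_curve_ring)
  show "p ^ n \<in> carrier (monomial_curve_ring a b)"
    using one_closed by (induction n) (simp_all add: monomial_curve_ring_simps mult)
qed

section \<open>Nonzero primes are maximal\<close>

text \<open>
  More than \<open>N\<close> vectors in an \<open>N\<close>-dimensional space are dependent. The induction is one column of
  Gaussian elimination: a vector \<open>r p\<close> with nonzero coefficient at \<open>N\<close> clears that coefficient in all
  the others, and a relation among the results becomes a relation among the original vectors.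
  Indexing by a set \<open>A\<close>, instead of treating a set of polynomials, allows repetitions.
\<close>

lemma linear_dependence_of_bounded_degree:
  fixes r :: "'i \<Rightarrow> 'k::field poly"
  assumes "finite A" "N < card A" "\<And>i j. i \<in> A \<Longrightarrow> N \<le> j \<Longrightarrow> coeff (r i) j = 0"
  shows "\<exists>c. (\<exists>i\<in>A. c i \<noteq> 0) \<and> (\<Sum>i\<in>A. smult (c i) (r i)) = 0"
  using assms
proof (induction N arbitrary: A r)
  case 0
  then obtain i where "i \<in> A"
    by fastforce
  moreover have "r i = 0" if "i \<in> A" for i
    using 0(3)[OF that] by (simp add: poly_eq_iff)
  ultimately show ?case
    by (intro exI[of _ "\<lambda>_. 1"]) auto
next
  case (Suc N)
  show ?case
  proof (cases "\<exists>p\<in>A. coeff (r p) N \<noteq> 0")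
    case False
    have "coeff (r i) j = 0" if "i \<in> A" "N \<le> j" for i j
      using that False Suc.prems(3)[of i j] by (cases "j = N") auto
    then show ?thesis
      using Suc.IH[of A r] Suc.prems by auto
  next
    case True
    then obtain p where p: "p \<in> A" "coeff (r p) N \<noteq> 0"
      by blast
    define e where "e i = coeff (r i) N / coeff (r p) N" for i
    define s where "s i = r i - smult (e i) (r p)" for i
    have "coeff (s i) j = 0" if "i \<in> A - {p}" "N \<le> j" for i j
      using that p Suc.prems(3)[of i j] Suc.prems(3)[of p j]
      by (cases "j = N") (auto simp: s_def e_def)
    moreover have "finite (A - {p})" "N < card (A - {p})"
      using Suc.prems p(1) by auto
    ultimately obtain c where c: "\<exists>i\<in>A - {p}. c i \<noteq> 0"
      "(\<Sum>i\<in>A - {p}. smult (c i) (s i)) = 0"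
      using Suc.IH[of "A - {p}" s] by blast
    \<comment> \<open>The coefficient of the pivot collects the multiples of \<open>r p\<close> that were subtracted.\<close>
    define c' where "c' = c(p := - (\<Sum>i\<in>A - {p}. c i * e i))"
    have "(\<Sum>i\<in>A. smult (c' i) (r i)) =
        smult (c' p) (r p) + (\<Sum>i\<in>A - {p}. smult (c' i) (r i))"
      using Suc.prems(1) p(1) by (rule sum.remove)
    also have "(\<Sum>i\<in>A - {p}. smult (c' i) (r i)) = (\<Sum>i\<in>A - {p}. smult (c i) (r i))"
      by (intro sum.cong) (auto simp: c'_def)
    also have "smult (c' p) (r p) + \<dots> = (\<Sum>i\<in>A - {p}. smult (c i) (s i))"
      by (simp add: c'_def s_def smult_diff_right sum_subtractf smult_sum)
    finally have "(\<Sum>i\<in>A. smult (c' i) (r i)) = 0"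
      using c(2) by simp
    moreover have "\<exists>i\<in>A. c' i \<noteq> 0"
      using c(1) by (auto simp: c'_def)
    ultimately show ?thesis
      by blast
  qed
qed

text \<open>
  Division with remainder inside \<open>R\<close>. Cancelling the term of degree \<open>n\<close> takes a multiple of
  \<open>t^(n - deg f)\<close>, which is in \<open>R\<close> as soon as \<open>n - deg f\<close> exceeds the Frobenius number; \<open>a b\<close> is a
  crude but simple upper bound for that number. Consequently \<open>R/(f)\<close> is spanned by the classes of
  finitely many monomials.
\<close>

lemma reduce_modulo_element:
  fixes f p :: "'k::field poly"
  assumes ab: "coprime a b" "0 < a"
    and f: "f \<noteq> 0"
    and p: "p \<in> carrier (monomial_curve_ring a b)"
    and fR: "f \<in> carrier (monomial_curve_ring a b)"
  shows "\<exists>q\<in>carrier (monomial_curve_ring a b).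
           \<forall>j \<ge> degree f + a * b. coeff (p - q * f) j = 0"
proof -
  have "\<exists>q\<in>carrier (monomial_curve_ring a b). \<forall>j \<ge> degree f + a * b. coeff (p - q * f) j = 0"
    if "p \<in> carrier (monomial_curve_ring a b)" "\<forall>j\<ge>n. coeff p j = 0" for n and p :: "'k poly"
    using that
  proof (induction n arbitrary: p)
    case 0
    then show ?case
      using const_in_monomial_curve_ring[of 0] by (intro bexI[of _ 0]) auto
  next
    case (Suc n)
    show ?case
    proof (cases "n < degree f + a * b")
      case True
      then show ?thesis
        using const_in_monomial_curve_ring[of 0] Suc.prems by (intro bexI[of _ 0]) auto
    next
      case False
      define m where "m = monom (coeff p n / lead_coeff f) (n - degree f)"
      have "n - degree f \<in> semigroup2 a b"
        using ab False by (intro in_semigroup2_if_above_frobenius) auto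
      then have m: "m \<in> carrier (monomial_curve_ring a b)"
        by (simp add: m_def monom_in_monomial_curve_ring)
      have "p + - (m * f) \<in> carrier (monomial_curve_ring a b)"
        by (intro monomial_curve_ring_closed Suc.prems m fR)
      moreover have "coeff (p + - (m * f)) j = 0" if "n \<le> j" for j
      proof (cases "j = n")
        case True
        then show ?thesis
          using False f by (simp add: m_def coeff_monom_mult)
      next
        case j: False
        then have "degree f < j - (n - degree f)"
          using that False by auto
        then show ?thesis
          using that j Suc.prems(2) by (simp add: m_def coeff_monom_mult coeff_eq_0)
      qed
      ultimately obtain q where q: "q \<in> carrier (monomial_curve_ring a b)"
        "\<forall>j \<ge> degree f + a * b. coeff (p + - (m * f) - q * f) j = 0"
        using Suc.IH[of "p + - (m * f)"] by blast
      have "p - (m + q) * f = p + - (m * f) - q * f"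
        by (simp add: algebra_simps)
      then have "\<forall>j \<ge> degree f + a * b. coeff (p - (m + q) * f) j = 0"
        using q(2) by metis
      then show ?thesis
        using monomial_curve_ring_closed(1)[OF m q(1)] by blast
    qed
  qed
  from this[OF p, of "Suc (degree p)"] show ?thesis
    by (simp add: coeff_eq_0)
qed

text \<open>
  The powers of \<open>q\<close> have remainders modulo \<open>f\<close> of bounded degree, so finitely many of them are
  linearly dependent.
\<close>

lemma algebraic_modulo_element:
  fixes f q :: "'k::field poly"
  assumes "coprime a b" "0 < a" "f \<noteq> 0"
    and f: "f \<in> carrier (monomial_curve_ring a b)"
    and q: "q \<in> carrier (monomial_curve_ring a b)"
  obtains N c h where "\<exists>i\<le>N. c i \<noteq> 0" "h \<in> carrier (monomial_curve_ring a b)"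
    "(\<Sum>i\<le>N. smult (c i) (q ^ i)) = h * f"
proof -
  let ?N = "degree f + a * b"
  have "\<exists>u. u \<in> carrier (monomial_curve_ring a b) \<and> (\<forall>j \<ge> ?N. coeff (q ^ i - u * f) j = 0)" for i
    using reduce_modulo_element[OF assms(1-3) monomial_curve_ring_closed(5)[OF q, of i] f] by blast
  then obtain u where u: "\<And>i. u i \<in> carrier (monomial_curve_ring a b)"
    "\<And>i j. j \<ge> ?N \<Longrightarrow> coeff (q ^ i - u i * f) j = 0"
    by metis
  obtain c where c: "\<exists>i\<in>{..?N}. c i \<noteq> 0" "(\<Sum>i\<le>?N. smult (c i) (q ^ i - u i * f)) = 0"
    using linear_dependence_of_bounded_degree[of "{..?N}" ?N "\<lambda>i. q ^ i - u i * f"] u(2) by auto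
  have "(\<Sum>i\<le>n. smult (c i) (u i)) \<in> carrier (monomial_curve_ring a b)" for n
    by (induction n) (simp_all add: monomial_curve_ring_closed u(1))
  moreover have "(\<Sum>i\<le>?N. smult (c i) (q ^ i)) = (\<Sum>i\<le>?N. smult (c i) (u i)) * f"
    using c(2) by (simp add: smult_diff_right sum_subtractf sum_distrib_right)
  ultimately show ?thesis
    using that c(1) by blast
qed

text \<open>
  Suppose \<open>q \<in> Q\<close> and \<open>q \<notin> P\<close>. A polynomial relation for \<open>q\<close> modulo \<open>P\<close> has constant coefficient in
  \<open>Q\<close>, hence zero because \<open>Q\<close> contains no units. As \<open>P\<close> is prime and \<open>q \<notin> P\<close>, a factor \<open>q\<close> can be
  cancelled, which leaves a shorter relation. So only the trivial relation exists,
  although \<open>q\<close> is algebraic modulo \<open>f \<in> P\<close>.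
\<close>

lemma nonzero_prime_maximal:
  fixes P Q :: "'k::field poly set"
  assumes ab: "coprime a b" "0 < a"
    and P: "primeideal P (monomial_curve_ring a b)" and Q: "primeideal Q (monomial_curve_ring a b)"
    and f: "f \<in> P" "f \<noteq> 0"
  shows "\<not> P \<subset> Q"
proof
  assume PQ: "P \<subset> Q"
  interpret P: primeideal P "monomial_curve_ring a b :: 'k poly ring" by (rule P)
  interpret Q: primeideal Q "monomial_curve_ring a b :: 'k poly ring" by (rule Q)
  note simps = monomial_curve_ring_simps
  note closed = monomial_curve_ring_closed
  obtain q where q: "q \<in> Q" "q \<notin> P"
    using PQ by blast
  have qR: "q \<in> carrier (monomial_curve_ring a b)"
    using q(1) by (rule Q.Icarr)
  have const: "c = 0" if "[:c:] \<in> Q" for c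
  proof (rule ccontr)
    assume "c \<noteq> 0"
    have "[:inverse c:] * [:c:] \<in> Q"
      using Q.I_l_closed[OF that const_in_monomial_curve_ring[of "inverse c"]] by (simp add: simps)
    with \<open>c \<noteq> 0\<close> have "1 \<in> Q"
      by (simp add: one_pCons)
    then show False
      using Q.one_imp_carrier Q.I_notcarr by (simp add: simps)
  qed
  have no_relation: "c i = 0" if "(\<Sum>i\<le>n. smult (c i) (q ^ i)) \<in> P" "i \<le> n" for n c i
    using that
  proof (induction n arbitrary: c i)
    case 0
    then show ?case
      using const[of "c 0"] PQ by (auto simp: one_pCons)
  next
    case (Suc n)
    define h where "h = (\<Sum>i\<le>n. smult (c (Suc i)) (q ^ i))"
    have h: "h \<in> carrier (monomial_curve_ring a b)"
      unfolding h_def by (induction n) (simp_all add: closed qR const_in_monomial_curve_ring)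
    have sum: "(\<Sum>i\<le>Suc n. smult (c i) (q ^ i)) = [:c 0:] + q * h"
      by (simp add: sum.atMost_Suc_shift h_def sum_distrib_left one_pCons del: sum.atMost_Suc)
    have "q * (- h) \<in> Q"
      using Q.I_r_closed[OF q(1) closed(3)[OF h]] by (simp add: simps)
    then have "([:c 0:] + q * h) + q * (- h) \<in> Q"
      using Q.a_closed[of "[:c 0:] + q * h" "q * (- h)"] Suc.prems(1) PQ sum by (auto simp: simps)
    then have c0: "c 0 = 0"
      by (intro const) simp
    then have "q * h \<in> P"
      using Suc.prems(1) sum by simp
    then have "h \<in> P"
      using P.I_prime[OF qR h] q(2) by (simp add: simps)
    then have "c (Suc j) = 0" if "j \<le> n" for j
      using Suc.IH[of "\<lambda>i. c (Suc i)" j] that by (simp add: h_def)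
    with c0 Suc.prems(2) show ?case
      by (cases i) auto
  qed
  obtain N c h where c: "\<exists>i\<le>N. c i \<noteq> 0" "h \<in> carrier (monomial_curve_ring a b)"
    "(\<Sum>i\<le>N. smult (c i) (q ^ i)) = h * f"
    using algebraic_modulo_element[OF ab f(2) P.Icarr[OF f(1)] qR] by blast
  have "h * f \<in> P"
    using P.I_l_closed[OF f(1) c(2)] by (simp add: simps)
  then show False
    using no_relation[OF _ ] c by metis
qed

section \<open>Krull dimensions\<close>

lemma prime_chain_le_krull_dim:
  assumes "\<And>i. i \<le> n \<Longrightarrow> primeideal (P i) R" "\<And>i. i < n \<Longrightarrow> P i \<subset> P (Suc i)"
  shows "enat n \<le> krull_dim R"
  unfolding krull_dim_def using assms by (intro Sup_upper) blast

lemma krull_dim_le: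
  assumes "\<And>P. (\<forall>i\<le>Suc n. primeideal (P i) R) \<Longrightarrow> (\<forall>i\<le>n. P i \<subset> P (Suc i)) \<Longrightarrow> False"
  shows "krull_dim R \<le> enat n"
  unfolding krull_dim_def
proof (intro Sup_least, clarify)
  fix m and P :: "nat \<Rightarrow> 'a set"
  assume P: "\<forall>i\<le>m. primeideal (P i) R" "\<forall>i<m. P i \<subset> P (Suc i)"
  have "m \<le> n"
  proof (rule ccontr)
    assume "\<not> m \<le> n"
    then show False
      using P by (intro assms[of P]) auto
  qed
  then show "enat m \<le> enat n"
    by simp
qed

text \<open>
  Primes of the quotient pull back to primes of \<open>R\<close> above \<open>I\<close>, and surjectivity of the projection
  keeps inclusions strict.
\<close>

lemma (in cring) krull_dim_quotient_eq_0:
  assumes I: "ideal I R"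
    and max: "\<And>P Q. primeideal P R \<Longrightarrow> primeideal Q R \<Longrightarrow> I \<subseteq> P \<Longrightarrow> \<not> P \<subset> Q"
  shows "krull_dim (R Quot I) = 0"
proof -
  have zero: "\<zero>\<^bsub>R Quot I\<^esub> = I"
    and carrier: "carrier (R Quot I) = (\<Union>r\<in>carrier R. {I +> r})"
    by (simp_all only: FactRing_def ring.simps partial_object.simps A_RCOSETS_def')
  interpret I: ideal I R by (rule I)
  interpret h: ring_hom_ring R "R Quot I" "(+>) I"
    by (rule I.rcos_ring_hom_ring)
  define pre where "pre J = {r \<in> carrier R. I +> r \<in> J}" for J
  have "krull_dim (R Quot I) \<le> enat 0"
  proof (rule krull_dim_le)
    fix P assume P: "\<forall>i\<le>Suc 0. primeideal (P i) (R Quot I)" "\<forall>i\<le>0. P i \<subset> P (Suc i)"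
    have prime: "primeideal (pre (P i)) R" if "i \<le> 1" for i
      unfolding pre_def using P(1) that by (intro h.primeideal_vimage is_cring) auto
    interpret P0: primeideal "P 0" "R Quot I"
      using P(1) by simp
    interpret P1: primeideal "P 1" "R Quot I"
      using P(1) by simp
    have "I +> r \<in> P 0" if "r \<in> I" for r
    proof -
      have "I +> r = I"
        using that by (rule I.a_rcos_const)
      then show ?thesis
        using P0.zero_closed unfolding zero by (simp only:)
    qed
    then have "I \<subseteq> pre (P 0)"
      by (auto simp: pre_def)
    moreover obtain y where y: "y \<in> P 1" "y \<notin> P 0"
      using P(2) by auto
    moreover from y(1) have "y \<in> carrier (R Quot I)"
      by (rule P1.Icarr)
    then obtain r where "r \<in> carrier R" "y = I +> r"
      unfolding carrier by blast
    with y have "pre (P 0) \<subset> pre (P 1)"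
      using P(2) by (auto simp: pre_def)
    ultimately show False
      using max[of "pre (P 0)" "pre (P 1)"] prime by simp
  qed
  then show ?thesis
    by (simp add: zero_enat_def[symmetric])
qed

text \<open>
  The zero ideal is a prime strictly below the ideal of elements without constant term, which is
  prime as the preimage of the zero ideal under evaluation at \<open>0\<close>. In a chain with two strict
  inclusions the second one would start from a nonzero prime.
\<close>

lemma krull_dim_monomial_curve_ring:
  assumes "coprime a b" "0 < a"
  shows "krull_dim (monomial_curve_ring a b :: 'k::field poly ring) = 1"
proof (rule antisym)
  let ?R = "monomial_curve_ring a b :: 'k poly ring"
  let ?K = "cring_class_ops :: 'k ring"
  interpret R: domain ?R
    by (rule domain_monomial_curve_ring)
  have K: "domain ?K" "ring ?K"
    using field_class field.axioms(1) domain.axioms(1) cring.axioms(1) by blast+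
  have "krull_dim ?R \<le> enat 1"
  proof (rule krull_dim_le)
    fix P assume P: "\<forall>i\<le>Suc 1. primeideal (P i) ?R" "\<forall>i\<le>1. P i \<subset> P (Suc i)"
    interpret P0: primeideal "P 0" ?R
      using P(1) by simp
    have "0 \<in> P 0"
      using P0.zero_closed by (simp add: monomial_curve_ring_simps)
    moreover have "P 0 \<subset> P 1"
      using P(2)[rule_format, of 0] by simp
    ultimately obtain f where "f \<in> P 1" "f \<noteq> 0"
      by blast
    moreover have "P 1 \<subset> P (Suc 1)"
      using P(2) by blast
    moreover have "primeideal (P 1) ?R" "primeideal (P (Suc 1)) ?R"
      using P(1) by auto
    ultimately show False
      using nonzero_prime_maximal[OF assms] by blast
  qed
  then show "krull_dim ?R \<le> 1"
    by (simp add: one_enat_def)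
  interpret h: ring_hom_ring ?R ?K "\<lambda>p. coeff p 0"
    by (rule ring_hom_ringI)
      (simp_all add: R.ring_axioms K(2) class_simps monomial_curve_ring_simps coeff_mult_0)
  define m where "m = {p \<in> carrier ?R. coeff p 0 \<in> {\<zero>\<^bsub>?K\<^esub>}}"
  have "primeideal m ?R"
    unfolding m_def by (rule h.primeideal_vimage[OF R.is_cring domain.zeroprimeideal[OF K(1)]])
  moreover have "{0} \<subset> m"
  proof -
    have "monom 1 a \<in> m"
      using assms(2) by (simp add: m_def class_simps monom_in_monomial_curve_ring left_in_semigroup2)
    moreover have "monom 1 a \<noteq> (0 :: 'k poly)"
      by simp
    moreover have "0 \<in> m"
      using R.zero_closed by (simp add: m_def class_simps monomial_curve_ring_simps)
    ultimately show ?thesis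
      by blast
  qed
  moreover have "primeideal {0} ?R"
    using R.zeroprimeideal by (simp add: monomial_curve_ring_simps)
  ultimately have "enat 1 \<le> krull_dim ?R"
    by (intro prime_chain_le_krull_dim[where P = "\<lambda>i. if i = 0 then {0} else m"]) auto
  then show "1 \<le> krull_dim ?R"
    by (simp add: one_enat_def)
qed

section \<open>Homogeneous parameters and the generalized graded length\<close>

lemma genideal_singleton_monomial_curve_ring:
  fixes x :: "'k::field poly"
  assumes "x \<in> carrier (monomial_curve_ring a b)"
  shows "genideal (monomial_curve_ring a b) {x} = {y * x | y. y \<in> carrier (monomial_curve_ring a b)}"
proof -
  interpret R: cring "monomial_curve_ring a b :: 'k poly ring"
    by (rule cring_monomial_curve_ring)
  show ?thesis
    using R.cgenideal_eq_genideal[OF assms] by (simp add: cgenideal_def monomial_curve_ring_simps)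
qed

lemma grading_subset_tail_ideal:
  assumes "cring R" "G i \<subseteq> carrier R" "n \<le> i" "x \<in> G i"
  shows "x \<in> tail_ideal R G n"
proof -
  interpret cring R by (rule assms)
  have "finsum R (\<lambda>_. x) {i} = x"
    using assms by (subst finsum_insert) auto
  then show ?thesis
    unfolding tail_ideal_def using assms by (intro CollectI exI[of _ "\<lambda>_. x"] exI[of _ "{i}"]) auto
qed

lemma tail_ideal_subset_ideal:
  assumes "ideal J R" "\<And>i. n \<le> i \<Longrightarrow> G i \<subseteq> J"
  shows "tail_ideal R G n \<subseteq> J"
proof
  interpret J: ideal J R by (rule assms)
  fix x assume "x \<in> tail_ideal R G n"
  then obtain f I where I: "finite I" "I \<subseteq> {n..}" "\<forall>i\<in>I. f i \<in> G i" "x = finsum R f I"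
    by (auto simp: tail_ideal_def)
  have "\<forall>i\<in>I. f i \<in> J"
    using I assms(2) by fastforce
  with I(1) have "finsum R f I \<in> J"
  proof induction
    case (insert i I)
    then have "finsum R f (insert i I) = f i \<oplus>\<^bsub>R\<^esub> finsum R f I"
      by (intro J.finsum_insert) (auto intro: J.Icarr)
    with insert show ?case
      by simp
  qed simp
  with I show "x \<in> J"
    by simp
qed

lemma homogeneous_sop_monom:
  assumes "coprime a b" "0 < a" "0 < d" "d \<in> semigroup2 a b"
  shows "homogeneous_sop (monomial_curve_ring a b) (monomial_curve_grading a b)
           [monom (1 :: 'k::field) d]"
proof -
  let ?R = "monomial_curve_ring a b :: 'k poly ring"
  interpret R: cring ?R
    by (rule cring_monomial_curve_ring)
  have d: "monom 1 d \<in> carrier ?R"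
    using assms by (simp add: monom_in_monomial_curve_ring)
  have "krull_dim (?R Quot genideal ?R {monom 1 d}) = 0"
  proof (rule R.krull_dim_quotient_eq_0)
    show "ideal (genideal ?R {monom 1 d}) ?R"
      using d by (intro R.genideal_ideal) simp
    fix P Q assume "primeideal P ?R" "primeideal Q ?R" "genideal ?R {monom 1 d} \<subseteq> P"
    moreover have "monom 1 d \<in> genideal ?R {monom 1 d}"
      using d by (rule R.genideal_self')
    ultimately show "\<not> P \<subset> Q"
      using nonzero_prime_maximal[OF assms(1,2), of P Q "monom 1 d"] by auto
  qed
  then show ?thesis
    using d assms
    by (auto simp: homogeneous_sop_def krull_dim_monomial_curve_ring one_enat_def
        monomial_curve_grading_def)
qed

text \<open>
  The inequality on the right says \<open>n > F + d\<close> for the Frobenius number \<open>F = a b - a - b\<close>, and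
  \<open>a + b \<le> a b\<close> says that \<open>F\<close> is a natural number. If \<open>n \<le> F + d\<close>, then the monomial of degree
  \<open>F + d\<close> is in the tail ideal, but its cofactor would have a term of degree \<open>F\<close>. If \<open>n > F + d\<close>,
  the cofactors have degree above \<open>F\<close>, hence exist in \<open>R\<close>.
\<close>

lemma tail_ideal_subset_monom_iff:
  assumes "coprime a b" "0 < a" "0 < b" "a + b \<le> a * b"
    and d: "0 < d" "d \<in> semigroup2 a b" and c: "c \<noteq> 0"
  shows "tail_ideal (monomial_curve_ring a b) (monomial_curve_grading a b) n
           \<subseteq> genideal (monomial_curve_ring a b) {monom (c :: 'k::field) d}
         \<longleftrightarrow> a * b + d < n + a + b"
proof -
  let ?R = "monomial_curve_ring a b :: 'k poly ring"
  let ?G = "monomial_curve_grading a b :: nat \<Rightarrow> 'k poly set"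
  interpret R: cring ?R
    by (rule cring_monomial_curve_ring)
  have x: "monom c d \<in> carrier ?R"
    using d by (simp add: monom_in_monomial_curve_ring)
  note gen = genideal_singleton_monomial_curve_ring[OF x]
  show ?thesis
  proof
    assume sub: "tail_ideal ?R ?G n \<subseteq> genideal ?R {monom c d}"
    show "a * b + d < n + a + b"
    proof (rule ccontr)
      assume n: "\<not> a * b + d < n + a + b"
      define F where "F = a * b - a - b"
      have F: "F + a + b = a * b"
        using assms(4) by (simp add: F_def)
      have "F + d \<in> semigroup2 a b"
        using assms F d by (intro in_semigroup2_if_above_frobenius) auto
      then have "monom 1 (F + d) \<in> ?G (F + d)"
        by (auto simp: monomial_curve_grading_def monom_in_monomial_curve_ring)
      moreover have "n \<le> F + d" "?G (F + d) \<subseteq> carrier ?R"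
        using n F by (auto simp: monomial_curve_grading_def)
      ultimately have "monom 1 (F + d) \<in> tail_ideal ?R ?G n"
        using R.is_cring by (intro grading_subset_tail_ideal)
      with sub gen obtain y where y: "y \<in> carrier ?R" "monom 1 (F + d) = y * monom c d"
        by blast
      have "1 = coeff (monom c d * y) (F + d)"
        by (metis y(2) coeff_monom mult.commute)
      also have "\<dots> = c * coeff y F"
        by (simp add: coeff_monom_mult)
      finally have "coeff y F \<noteq> 0"
        by auto
      then have "F \<in> semigroup2 a b"
        using y(1) by (simp add: carrier_monomial_curve_ring)
      then show False
        using frobenius_notin_semigroup2[OF assms(1-3) F] by simp
    qed
  next
    assume n: "a * b + d < n + a + b"
    show "tail_ideal ?R ?G n \<subseteq> genideal ?R {monom c d}"
    proof (rule tail_ideal_subset_ideal)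
      show "ideal (genideal ?R {monom c d}) ?R"
        using x by (intro R.genideal_ideal) simp
      fix i assume i: "n \<le> i"
      have "i - d \<in> semigroup2 a b"
        using assms(1,2,4) n i by (intro in_semigroup2_if_above_frobenius) linarith+
      moreover have "monom e i = monom (e / c) (i - d) * monom c d" for e
        using n i assms(4) c by (simp add: mult_monom)
      ultimately show "?G i \<subseteq> genideal ?R {monom c d}"
        unfolding gen monomial_curve_grading_def
        by (smt (verit) mem_Collect_eq monom_in_monomial_curve_ring subsetI)
    qed
  qed
qed

theorem corollary4p5:
  fixes a b :: nat
  assumes "1 < a" and "a < b" and "coprime a b"
  shows "ggl (monomial_curve_ring a b :: 'k::field poly ring) (monomial_curve_grading a b)
           = b * a - b + 1"
proof -
  let ?R = "monomial_curve_ring a b :: 'k poly ring"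
  let ?G = "monomial_curve_grading a b :: nat \<Rightarrow> 'k poly set"
  interpret R: cring ?R
    by (rule cring_monomial_curve_ring)
  have "2 * b \<le> a * b"
    using assms by (intro mult_le_mono1) simp
  then have ab: "a + b \<le> a * b" "0 < a" "0 < b"
    using assms by linarith+
  obtain m where m: "b * a - b = m" "m + b = a * b"
    using ab by (simp add: mult.commute[of b a])
  note iff = tail_ideal_subset_monom_iff[OF assms(3) ab(2,3,1), where 'k = 'k]
  show ?thesis
    unfolding ggl_def m(1)
  proof (rule Least_equality)
    let ?n = "m + 1"
    have "tail_ideal ?R ?G ?n \<subseteq> genideal ?R (set [monom 1 a])"
      using iff[of a 1 ?n] ab(2) m(2) left_in_semigroup2[of a b] by simp
    moreover have "0 < ?n"
      by simp
    ultimately show "0 < ?n \<and> (\<exists>xs. homogeneous_sop ?R ?G xs \<and> tail_ideal ?R ?G ?n \<subseteq> genideal ?R (set xs))"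
      using homogeneous_sop_monom[OF assms(3) ab(2,2) left_in_semigroup2] by blast
  next
    fix n
    assume "0 < n \<and> (\<exists>xs. homogeneous_sop ?R ?G xs \<and> tail_ideal ?R ?G n \<subseteq> genideal ?R (set xs))"
    then obtain xs where xs: "homogeneous_sop ?R ?G xs"
      "tail_ideal ?R ?G n \<subseteq> genideal ?R (set xs)"
      by blast
    have "length xs = 1"
      using xs(1) krull_dim_monomial_curve_ring[OF assms(3) ab(2), where 'k = 'k]
      by (simp add: homogeneous_sop_def one_enat_def)
    then obtain x where x: "xs = [x]"
      by (auto simp: length_Suc_conv)
    then obtain d c where d: "0 < d" "x = monom c d" "x \<in> carrier ?R"
      using xs(1) by (auto simp: homogeneous_sop_def monomial_curve_grading_def)
    \<comment> \<open>The zero ideal misses \<open>t^(a n)\<close>, whose degree is at least \<open>n\<close>.\<close>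
    have "c \<noteq> 0"
    proof
      assume "c = 0"
      then have "tail_ideal ?R ?G n \<subseteq> {0}"
        using xs(2) x d R.genideal_zero by (simp add: monomial_curve_ring_simps)
      moreover have "monom 1 (a * n) \<in> tail_ideal ?R ?G n"
        using ab semigroup2I[of a n b 0]
        by (intro grading_subset_tail_ideal[where i = "a * n"] R.is_cring)
          (auto simp: monomial_curve_grading_def monom_in_monomial_curve_ring)
      ultimately show False
        by auto
    qed
    with d have S: "d \<in> semigroup2 a b"
      by (simp add: monom_in_monomial_curve_ring)
    have "a \<le> d"
      using less_imp_le[OF assms(2)] S d(1) by (rule le_if_pos_in_semigroup2)
    moreover have "a * b + d < n + a + b"
      using iff[OF d(1) S \<open>c \<noteq> 0\<close>] xs(2) x d(2) by simp
    ultimately show "m + 1 \<le> n"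
      using m(2) by linarith
  qed
qed

end
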